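(* Let $\mathcal{C},\mathcal{D}$ be categories and $F\colon\mathcal{C}\to\mathcal{D}^{op}$ left adjoint to $G\colon\mathcal{D}^{op}\to\mathcal{C}$. Let $B$ be an endofunctor on $\mathcal{C}$ with final coalgebra $\zeta\colon\Theta\xrightarrow{\cong}B(\Theta)$, $(T,\eta,\mu)$ a monad on $\mathcal{C}$, $\kappa\colon TB\Rightarrow BT$ an Eilenberg-Moore law, $L$ an endofunctor on $\mathcal{D}$ with initial algebra $\alpha\colon L(\Phi)\xrightarrow{\cong}\Phi$, $\delta\colon BG\Rightarrow GL$ a natural transformation and $\tau\colon TG\Rightarrow G$ a monad action. Let $a\colon T(\Theta)\to\Theta$ be the unique map with $\zeta\circ a=B(a)\circ\kappa_\Theta\circ T(\zeta)$, let $\ell_{\mathrm{em}}=\zeta^{-1}\circ B(a)\colon BT(\Theta)\to\Theta$, let $\ell^{\mathrm{log}}=G(\alpha^{-1})\circ\delta_\Phi\circ B(\tau_\Phi)\colon BTG(\Phi)\to G(\Phi)$, and let $\mathsf{e}\colon\Theta\to G(\Phi)$ be the unique map with $\mathsf{e}=G(\alpha^{-1})\circ\delta_\Phi\circ B(\mathsf{e})\circ\zeta$. Assume $\delta\circ B\tau\circ\kappa G=\tau L\circ T\delta$ (as natural transformations $TBG\Rightarrow GL$). Then $\mathsf{e}\circ\ell_{\mathrm{em}}=\ell^{\mathrm{log}}\circ BT(\mathsf{e})$. Consequently, for every coalgebra $c\colon X\to BT(X)$, $\mathsf{e}\circ\mathsf{em}_c=\mathsf{log}_c$, where $\mathsf{em}_c\colon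 X\to\Theta$ is the unique map with $\mathsf{em}_c=\ell_{\mathrm{em}}\circ BT(\mathsf{em}_c)\circ c$ and $\mathsf{log}_c\colon X\to G(\Phi)$ is the unique map with $\mathsf{log}_c=\ell^{\mathrm{log}}\circ BT(\mathsf{log}_c)\circ c$.
   Context: $L$ is also regarded as an endofunctor of $\mathcal{D}^{op}$; $\alpha^{-1}\colon\Phi\to L(\Phi)$ in $\mathcal{D}$ is a morphism $L(\Phi)\to\Phi$ in $\mathcal{D}^{op}$, so $G(\alpha^{-1})\colon GL(\Phi)\to G(\Phi)$. An Eilenberg-Moore law is a natural transformation $\kappa\colon TB\Rightarrow BT$ with $\kappa\circ\eta B=B\eta$ and $\kappa\circ\mu B=B\mu\circ\kappa T\circ T\kappa$. A monad action is a natural transformation $\tau\colon TG\Rightarrow G$ with $\tau\circ\eta G=\mathrm{id}$ and $\tau\circ\mu G=\tau\circ T\tau$. The maps $\mathsf{e}$, $\mathsf{em}_c$, $\mathsf{log}_c$ described exist and are unique (the algebras $G(\alpha^{-1})\circ\delta_\Phi$, $\ell_{\mathrm{em}}$ and $\ell^{\mathrm{log}}$ are corecursive). *)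

theory Defs
  imports Main
begin

record ('o, 'a) precategory =
  Ob  :: "'o set"
  Ar  :: "'a set"
  Dom :: "'a \<Rightarrow> 'o"
  Cod :: "'a \<Rightarrow> 'o"
  Idt :: "'o \<Rightarrow> 'a"
  Cmp :: "'a \<Rightarrow> 'a \<Rightarrow> 'a"  (infixr "\<cdot>\<index>" 70)

definition hom :: "('o, 'a) precategory \<Rightarrow> 'o \<Rightarrow> 'o \<Rightarrow> 'a set" where
  "hom C X Y = {f \<in> Ar C. Dom C f = X \<and> Cod C f = Y}"

locale category =
  fixes C :: "('o, 'a) precategory" (structure)
  assumes dom_ob: "f \<in> Ar C \<Longrightarrow> Dom C f \<in> Ob C"
    and cod_ob: "f \<in> Ar C \<Longrightarrow> Cod C f \<in> Ob C"
    and idt_hom: "X \<in> Ob C \<Longrightarrow> Idt C X \<in> hom C X X"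
    and cmp_hom: "\<lbrakk>f \<in> hom C X Y; g \<in> hom C Y Z\<rbrakk> \<Longrightarrow> g \<cdot> f \<in> hom C X Z"
    and cmp_idt: "f \<in> hom C X Y \<Longrightarrow> f \<cdot> Idt C X = f"
    and idt_cmp: "f \<in> hom C X Y \<Longrightarrow> Idt C Y \<cdot> f = f"
    and cmp_assoc: "\<lbrakk>f \<in> hom C X Y; g \<in> hom C Y Z; h \<in> hom C Z W\<rbrakk>
      \<Longrightarrow> (h \<cdot> g) \<cdot> f = h \<cdot> (g \<cdot> f)"

definition op_cat :: "('o, 'a) precategory \<Rightarrow> ('o, 'a) precategory" where
  "op_cat C = \<lparr>Ob = Ob C, Ar = Ar C, Dom = Cod C, Cod = Dom C, Idt = Idt C,
     Cmp = (\<lambda>g f. f \<cdot>\<^bsub>C\<^esub> g)\<rparr>"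

definition inverse_of :: "('o, 'a) precategory \<Rightarrow> 'a \<Rightarrow> 'a" where
  "inverse_of C f = (THE g. g \<in> hom C (Cod C f) (Dom C f) \<and>
     g \<cdot>\<^bsub>C\<^esub> f = Idt C (Dom C f) \<and> f \<cdot>\<^bsub>C\<^esub> g = Idt C (Cod C f))"

text \<open>
  A functor is given by its action on objects and arrows only. Hence the functor
  \<open>D\<^sup>o\<^sup>p \<rightarrow> E\<^sup>o\<^sup>p\<close> induced by a functor \<open>D \<rightarrow> E\<close> is literally the same pair of maps.
\<close>

record ('o, 'a, 'p, 'b) functor_data =
  fob :: "'o \<Rightarrow> 'p"  (infixr "\<odot>" 90)
  far :: "'a \<Rightarrow> 'b"  (infixr "\<star>" 90)

locale is_functor = C: category C + D: category D
  for C :: "('o, 'a) precategory" and D :: "('p, 'b) precategory"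
    and F :: "('o, 'a, 'p, 'b) functor_data" +
  assumes fob_ob: "X \<in> Ob C \<Longrightarrow> F \<odot> X \<in> Ob D"
    and far_hom: "f \<in> hom C X Y \<Longrightarrow> F \<star> f \<in> hom D (F \<odot> X) (F \<odot> Y)"
    and far_idt: "X \<in> Ob C \<Longrightarrow> F \<star> Idt C X = Idt D (F \<odot> X)"
    and far_cmp: "\<lbrakk>f \<in> hom C X Y; g \<in> hom C Y Z\<rbrakk>
      \<Longrightarrow> F \<star> (g \<cdot>\<^bsub>C\<^esub> f) = (F \<star> g) \<cdot>\<^bsub>D\<^esub> (F \<star> f)"

definition id_functor :: "('o, 'a, 'o, 'a) functor_data" where
  "id_functor = \<lparr>fob = (\<lambda>X. X), far = (\<lambda>f. f)\<rparr>"

definition comp_functor ::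
  "('p, 'b, 'q, 'c) functor_data \<Rightarrow> ('o, 'a, 'p, 'b) functor_data \<Rightarrow> ('o, 'a, 'q, 'c) functor_data"
  (infixr "\<circ>\<^sub>F" 95) where
  "G \<circ>\<^sub>F F = \<lparr>fob = (\<lambda>X. G \<odot> F \<odot> X), far = (\<lambda>f. G \<star> F \<star> f)\<rparr>"

locale nat_trans = F: is_functor C D F + G: is_functor C D G
  for C :: "('o, 'a) precategory" and D :: "('p, 'b) precategory"
    and F G :: "('o, 'a, 'p, 'b) functor_data" +
  fixes t :: "'o \<Rightarrow> 'b"
  assumes component: "X \<in> Ob C \<Longrightarrow> t X \<in> hom D (F \<odot> X) (G \<odot> X)"
    and naturality: "f \<in> hom C X Y \<Longrightarrow> t Y \<cdot>\<^bsub>D\<^esub> (F \<star> f) = (G \<star> f) \<cdot>\<^bsub>D\<^esub> t X"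

definition left_adjoint :: "('o, 'a) precategory \<Rightarrow> ('p, 'b) precategory \<Rightarrow>
    ('o, 'a, 'p, 'b) functor_data \<Rightarrow> ('p, 'b, 'o, 'a) functor_data \<Rightarrow> bool" where
  "left_adjoint C E F G \<longleftrightarrow> is_functor C E F \<and> is_functor E C G \<and>
     (\<exists>\<phi>. (\<forall>X \<in> Ob C. \<forall>Y \<in> Ob E. bij_betw (\<phi> X Y) (hom E (F \<odot> X) Y) (hom C X (G \<odot> Y))) \<and>
          (\<forall>X \<in> Ob C. \<forall>X' \<in> Ob C. \<forall>Y \<in> Ob E. \<forall>Y' \<in> Ob E.
            \<forall>u \<in> hom C X' X. \<forall>f \<in> hom E (F \<odot> X) Y. \<forall>v \<in> hom E Y Y'.
              \<phi> X' Y' (v \<cdot>\<^bsub>E\<^esub> f \<cdot>\<^bsub>E\<^esub> (F \<star> u)) = (G \<star> v) \<cdot>\<^bsub>C\<^esub> \<phi> X Y f \<cdot>\<^bsub>C\<^esub> u))"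

locale monad_on = T: is_functor C C T +
  unit: nat_trans C C id_functor T \<eta> + mult: nat_trans C C "T \<circ>\<^sub>F T" T \<mu>
  for C :: "('o, 'a) precategory" (structure) and T \<eta> \<mu> +
  assumes mult_assoc: "X \<in> Ob C \<Longrightarrow> \<mu> X \<cdot> (T \<star> \<mu> X) = \<mu> X \<cdot> \<mu> (T \<odot> X)"
    and unit_left: "X \<in> Ob C \<Longrightarrow> \<mu> X \<cdot> \<eta> (T \<odot> X) = Idt C (T \<odot> X)"
    and unit_right: "X \<in> Ob C \<Longrightarrow> \<mu> X \<cdot> (T \<star> \<eta> X) = Idt C (T \<odot> X)"

locale em_law = B: is_functor C C B + monad_on C T \<eta> \<mu> + \<kappa>: nat_trans C C "T \<circ>\<^sub>F B" "B \<circ>\<^sub>F T" \<kappa>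
  for C :: "('o, 'a) precategory" (structure) and B T \<eta> \<mu> \<kappa> +
  assumes em_unit: "X \<in> Ob C \<Longrightarrow> \<kappa> X \<cdot> \<eta> (B \<odot> X) = B \<star> \<eta> X"
    and em_mult: "X \<in> Ob C \<Longrightarrow>
      \<kappa> X \<cdot> \<mu> (B \<odot> X) = (B \<star> \<mu> X) \<cdot> \<kappa> (T \<odot> X) \<cdot> (T \<star> \<kappa> X)"

locale monad_action = monad_on C T \<eta> \<mu> + G: is_functor E C G + \<tau>: nat_trans E C "T \<circ>\<^sub>F G" G \<tau>
  for C :: "('o, 'a) precategory" (structure) and E :: "('p, 'b) precategory" and T \<eta> \<mu> G \<tau> +
  assumes action_unit: "Y \<in> Ob E \<Longrightarrow> \<tau> Y \<cdot> \<eta> (G \<odot> Y) = Idt C (G \<odot> Y)"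
    and action_mult: "Y \<in> Ob E \<Longrightarrow> \<tau> Y \<cdot> \<mu> (G \<odot> Y) = \<tau> Y \<cdot> (T \<star> \<tau> Y)"

definition final_coalgebra :: "('o, 'a) precategory \<Rightarrow> ('o, 'a, 'o, 'a) functor_data \<Rightarrow>
    'o \<Rightarrow> 'a \<Rightarrow> bool" where
  "final_coalgebra C B \<Theta> \<zeta> \<longleftrightarrow> \<Theta> \<in> Ob C \<and> \<zeta> \<in> hom C \<Theta> (B \<odot> \<Theta>) \<and>
     (\<forall>X \<in> Ob C. \<forall>c \<in> hom C X (B \<odot> X).
        \<exists>!f. f \<in> hom C X \<Theta> \<and> \<zeta> \<cdot>\<^bsub>C\<^esub> f = (B \<star> f) \<cdot>\<^bsub>C\<^esub> c)"

definition initial_algebra :: "('p, 'b) precategory \<Rightarrow> ('p, 'b, 'p, 'b) functor_data \<Rightarrow>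
    'p \<Rightarrow> 'b \<Rightarrow> bool" where
  "initial_algebra D L \<Phi> \<alpha> \<longleftrightarrow> \<Phi> \<in> Ob D \<and> \<alpha> \<in> hom D (L \<odot> \<Phi>) \<Phi> \<and>
     (\<forall>X \<in> Ob D. \<forall>b \<in> hom D (L \<odot> X) X.
        \<exists>!f. f \<in> hom D \<Phi> X \<and> f \<cdot>\<^bsub>D\<^esub> \<alpha> = b \<cdot>\<^bsub>D\<^esub> (L \<star> f))"

end

theory Submission
  imports Defs
begin

text \<open>
  Call an algebra \<open>l : B A \<rightarrow> A\<close> corecursive if every coalgebra \<open>c : X \<rightarrow> B X\<close> has exactly one
  \<open>h : X \<rightarrow> A\<close> with \<open>h = l \<circ> B h \<circ> c\<close>. If \<open>l\<close> is corecursive and \<open>t : T A \<rightarrow> A\<close> is an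
  Eilenberg-Moore algebra with \<open>t \<circ> T l = l \<circ> B t \<circ> \<kappa>\<close>, then \<open>l \<circ> B t\<close> is a corecursive
  \<open>BT\<close>-algebra: the solutions for \<open>c : X \<rightarrow> B T X\<close> correspond to those for its determinization
  \<open>B \<mu> \<circ> \<kappa> \<circ> T c\<close>. This applies both to \<open>(\<zeta>\<^sup>-\<^sup>1, a)\<close> and to \<open>(G \<alpha>\<^sup>-\<^sup>1 \<circ> \<delta>, \<tau>)\<close>, where the second
  algebra is corecursive by transposing along the adjunction to the initial algebra \<open>\<alpha>\<close>.
  Finally \<open>e \<circ> a\<close> and \<open>\<tau> \<circ> T e\<close> solve the same corecursive equation over \<open>\<kappa> \<circ> T \<zeta>\<close>, so \<open>e\<close> is
  a morphism between the two \<open>BT\<close>-algebras and maps solutions to solutions.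
\<close>

section \<open>Opposite categories, inverses and rewrite rules for arrows\<close>

lemma in_hom_iff: "f \<in> hom C X Y \<longleftrightarrow> f \<in> Ar C \<and> Dom C f = X \<and> Cod C f = Y"
  by (auto simp: hom_def)

lemma comp_functor_simps [simp]:
  "(G \<circ>\<^sub>F F) \<odot> X = G \<odot> F \<odot> X" "(G \<circ>\<^sub>F F) \<star> f = G \<star> F \<star> f"
  by (simp_all add: comp_functor_def)

lemma id_functor_simps [simp]: "id_functor \<odot> X = X" "id_functor \<star> f = f"
  by (simp_all add: id_functor_def)

lemma op_cat_simps [simp]:
  "Ob (op_cat C) = Ob C" "Ar (op_cat C) = Ar C" "Dom (op_cat C) = Cod C" "Cod (op_cat C) = Dom C"
  "Idt (op_cat C) = Idt C" "g \<cdot>\<^bsub>op_cat C\<^esub> f = f \<cdot>\<^bsub>C\<^esub> g" "hom (op_cat C) X Y = hom C Y X"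
  by (auto simp: op_cat_def hom_def)

text \<open>The two inverse laws merely trade places in the opposite category. Hence
  \<open>inverse_of D \<alpha>\<close> can be treated as an inverse in
  \<open>op_cat D\<close>.\<close>

lemma inverse_of_op_cat [simp]: "inverse_of (op_cat C) f = inverse_of C f"
  by (simp add: inverse_of_def conj_commute)

text \<open>
  The axioms of the locales restated through \<open>Dom\<close> and \<open>Cod\<close> instead of \<open>hom\<close>: their premises then
  contain no variables that are absent from the conclusion, so the simplifier can discharge them.
\<close>

context category
begin

lemma idt_simps [simp]:
  "X \<in> Ob C \<Longrightarrow> Idt C X \<in> Ar C" "X \<in> Ob C \<Longrightarrow> Dom C (Idt C X) = X"
  "X \<in> Ob C \<Longrightarrow> Cod C (Idt C X) = X"
  using idt_hom by (auto simp: in_hom_iff)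

lemma cmp_simps [simp]:
  assumes "f \<in> Ar C" "g \<in> Ar C" "Cod C f = Dom C g"
  shows "g \<cdot> f \<in> Ar C" "Dom C (g \<cdot> f) = Dom C f" "Cod C (g \<cdot> f) = Cod C g"
  using cmp_hom[of f "Dom C f" "Dom C g" g "Cod C g"] assms by (auto simp: in_hom_iff)

lemma dom_cod_ob [simp]: "f \<in> Ar C \<Longrightarrow> Dom C f \<in> Ob C" "f \<in> Ar C \<Longrightarrow> Cod C f \<in> Ob C"
  by (fact dom_ob cod_ob)+

lemma cmp_idt_simp [simp]: "f \<in> Ar C \<Longrightarrow> Dom C f = X \<Longrightarrow> f \<cdot> Idt C X = f"
  by (rule cmp_idt) (auto simp: in_hom_iff)

lemma idt_cmp_simp [simp]: "f \<in> Ar C \<Longrightarrow> Cod C f = X \<Longrightarrow> Idt C X \<cdot> f = f"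
  by (rule idt_cmp) (auto simp: in_hom_iff)

lemma cmp_assoc_simp [simp]:
  "\<lbrakk>f \<in> Ar C; g \<in> Ar C; h \<in> Ar C; Cod C f = Dom C g; Cod C g = Dom C h\<rbrakk>
    \<Longrightarrow> (h \<cdot> g) \<cdot> f = h \<cdot> g \<cdot> f"
  by (rule cmp_assoc) (auto simp: in_hom_iff)

text \<open>Composites are normalised to right-nested form, where \<open>g \<cdot> f\<close> is no
  longer a subterm once something is composed on the right. This form applies a known equation at
  the head of a longer chain.\<close>

lemma cmp_reassoc:
  "\<lbrakk>g \<cdot> f = k; x \<in> Ar C; f \<in> Ar C; g \<in> Ar C; Cod C x = Dom C f; Cod C f = Dom C g\<rbrakk>
    \<Longrightarrow> g \<cdot> f \<cdot> x = k \<cdot> x"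
  using cmp_assoc_simp by metis

lemma inverse_of_eqI:
  assumes "f \<in> hom C X Y" "g \<in> hom C Y X" "g \<cdot> f = Idt C X" "f \<cdot> g = Idt C Y"
  shows "inverse_of C f = g"
  unfolding inverse_of_def
proof (rule the_equality)
  show "g \<in> hom C (Cod C f) (Dom C f) \<and> g \<cdot> f = Idt C (Dom C f) \<and> f \<cdot> g = Idt C (Cod C f)"
    using assms by (auto simp: in_hom_iff)
next
  fix k
  assume k: "k \<in> hom C (Cod C f) (Dom C f) \<and> k \<cdot> f = Idt C (Dom C f) \<and> f \<cdot> k = Idt C (Cod C f)"
  have "k = k \<cdot> f \<cdot> g"
    using assms k by (auto simp: in_hom_iff)
  also have "\<dots> = (k \<cdot> f) \<cdot> g"
    using k assms(1) by (intro cmp_assoc[OF assms(2,1), of k X, symmetric]) (auto simp: in_hom_iff)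
  also have "\<dots> = g"
    using assms k by (auto simp: in_hom_iff simp del: cmp_assoc_simp)
  finally show "k = g" .
qed

end

context is_functor
begin

lemma functor_simps [simp]:
  assumes "f \<in> Ar C"
  shows "F \<star> f \<in> Ar D" "Dom D (F \<star> f) = F \<odot> Dom C f" "Cod D (F \<star> f) = F \<odot> Cod C f"
  using far_hom[of f "Dom C f" "Cod C f"] assms by (auto simp: in_hom_iff)

lemma functor_ob [simp]: "X \<in> Ob C \<Longrightarrow> F \<odot> X \<in> Ob D"
  by (fact fob_ob)

lemma functor_idt [simp]: "X \<in> Ob C \<Longrightarrow> F \<star> Idt C X = Idt D (F \<odot> X)"
  by (fact far_idt)

lemma functor_cmp [simp]:
  "\<lbrakk>f \<in> Ar C; g \<in> Ar C; Cod C f = Dom C g\<rbrakk> \<Longrightarrow> F \<star> (g \<cdot>\<^bsub>C\<^esub> f) = (F \<star> g) \<cdot>\<^bsub>D\<^esub> (F \<star> f)"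
  by (rule far_cmp) (auto simp: in_hom_iff)

end

lemma is_functor_op_cat:
  assumes "is_functor D D L" "category (op_cat D)"
  shows "is_functor (op_cat D) (op_cat D) L"
proof -
  interpret L: is_functor D D L by fact
  interpret E: category "op_cat D" by fact
  show ?thesis
    by unfold_locales (auto simp: in_hom_iff)
qed

context nat_trans
begin

lemma component_simps [simp]:
  assumes "X \<in> Ob C"
  shows "t X \<in> Ar D" "Dom D (t X) = F \<odot> X" "Cod D (t X) = G \<odot> X"
  using component[OF assms] by (auto simp: in_hom_iff)

text \<open>For rewriting, the naturality square is oriented both ways: components move to the left
  here and to the right in \<open>naturality_cod\<close>. A free object variable tied by a premise
  lets the left side match without a literal \<open>Dom C f\<close>.\<close>

lemma naturality_dom:
  "f \<in> Ar C \<Longrightarrow> Dom C f = X \<Longrightarrow> (G \<star> f) \<cdot>\<^bsub>D\<^esub> t X = t (Cod C f) \<cdot>\<^bsub>D\<^esub> (F \<star> f)"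
  using naturality[of f X "Cod C f"] by (simp add: in_hom_iff)

lemma naturality_cod:
  "f \<in> Ar C \<Longrightarrow> Cod C f = Y \<Longrightarrow> t Y \<cdot>\<^bsub>D\<^esub> (F \<star> f) = (G \<star> f) \<cdot>\<^bsub>D\<^esub> t (Dom C f)"
  using naturality[of f "Dom C f" Y] by (simp add: in_hom_iff)

end

section \<open>Corecursive algebras and final coalgebras\<close>

definition corecursive ::
  "('o, 'a) precategory \<Rightarrow> ('o, 'a, 'o, 'a) functor_data \<Rightarrow> 'o \<Rightarrow> 'a \<Rightarrow> bool" where
  "corecursive C B A l \<longleftrightarrow> A \<in> Ob C \<and> l \<in> hom C (B \<odot> A) A \<and>
     (\<forall>X \<in> Ob C. \<forall>c \<in> hom C X (B \<odot> X). \<exists>!h. h \<in> hom C X A \<and> h = l \<cdot>\<^bsub>C\<^esub> (B \<star> h) \<cdot>\<^bsub>C\<^esub> c)"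

lemma corecursive_unique:
  assumes "corecursive C B A l" "X \<in> Ob C" "c \<in> hom C X (B \<odot> X)"
    and "h \<in> hom C X A" "h = l \<cdot>\<^bsub>C\<^esub> (B \<star> h) \<cdot>\<^bsub>C\<^esub> c"
    and "k \<in> hom C X A" "k = l \<cdot>\<^bsub>C\<^esub> (B \<star> k) \<cdot>\<^bsub>C\<^esub> c"
  shows "h = k"
  using assms unfolding corecursive_def by blast

lemma final_coalgebra_unique:
  assumes "final_coalgebra C B \<Theta> \<zeta>" "X \<in> Ob C" "c \<in> hom C X (B \<odot> X)"
    and "h \<in> hom C X \<Theta>" "\<zeta> \<cdot>\<^bsub>C\<^esub> h = (B \<star> h) \<cdot>\<^bsub>C\<^esub> c"
    and "k \<in> hom C X \<Theta>" "\<zeta> \<cdot>\<^bsub>C\<^esub> k = (B \<star> k) \<cdot>\<^bsub>C\<^esub> c"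
  shows "h = k"
  using assms unfolding final_coalgebra_def by blast

text \<open>Lambek's lemma. The coalgebra \<open>B \<star> \<zeta>\<close> has a morphism
  \<open>g\<close> into \<open>\<zeta>\<close>; then \<open>g\<close> after \<open>\<zeta>\<close>
  is an endomorphism of the final coalgebra, hence the identity, and the square for \<open>g\<close>
  becomes the other inverse law.\<close>

lemma final_coalgebra_inverse:
  assumes "is_functor C C B" "final_coalgebra C B \<Theta> \<zeta>"
  shows "inverse_of C \<zeta> \<in> hom C (B \<odot> \<Theta>) \<Theta>"
    and "inverse_of C \<zeta> \<cdot>\<^bsub>C\<^esub> \<zeta> = Idt C \<Theta>"
    and "\<zeta> \<cdot>\<^bsub>C\<^esub> inverse_of C \<zeta> = Idt C (B \<odot> \<Theta>)"
proof -
  interpret B: is_functor C C B by fact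
  have \<Theta>: "\<Theta> \<in> Ob C" and \<zeta>: "\<zeta> \<in> hom C \<Theta> (B \<odot> \<Theta>)"
    using assms(2) by (auto simp: final_coalgebra_def)
  then have [simp]: "\<Theta> \<in> Ob C" "\<zeta> \<in> Ar C" "Dom C \<zeta> = \<Theta>" "Cod C \<zeta> = B \<odot> \<Theta>"
    by (auto simp: in_hom_iff)
  have "B \<odot> \<Theta> \<in> Ob C" "B \<star> \<zeta> \<in> hom C (B \<odot> \<Theta>) (B \<odot> B \<odot> \<Theta>)"
    by (simp_all add: in_hom_iff)
  then obtain g where g: "g \<in> hom C (B \<odot> \<Theta>) \<Theta>" "\<zeta> \<cdot>\<^bsub>C\<^esub> g = (B \<star> g) \<cdot>\<^bsub>C\<^esub> (B \<star> \<zeta>)"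
    using assms(2) unfolding final_coalgebra_def by blast
  have g' [simp]: "g \<in> Ar C" "Dom C g = B \<odot> \<Theta>" "Cod C g = \<Theta>"
    using g by (auto simp: in_hom_iff)
  have 1: "g \<cdot>\<^bsub>C\<^esub> \<zeta> = Idt C \<Theta>"
  proof (rule final_coalgebra_unique[OF assms(2) \<Theta> \<zeta>])
    show "\<zeta> \<cdot>\<^bsub>C\<^esub> g \<cdot>\<^bsub>C\<^esub> \<zeta> = (B \<star> (g \<cdot>\<^bsub>C\<^esub> \<zeta>)) \<cdot>\<^bsub>C\<^esub> \<zeta>"
      by (simp add: B.C.cmp_reassoc[OF g(2)])
  qed (simp_all add: in_hom_iff)
  have "\<zeta> \<cdot>\<^bsub>C\<^esub> g = B \<star> (g \<cdot>\<^bsub>C\<^esub> \<zeta>)"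
    by (simp add: g(2))
  then have 2: "\<zeta> \<cdot>\<^bsub>C\<^esub> g = Idt C (B \<odot> \<Theta>)"
    by (simp only: 1) simp
  have "inverse_of C \<zeta> = g"
    using \<zeta> g(1) 1 2 by (rule B.C.inverse_of_eqI)
  then show "inverse_of C \<zeta> \<in> hom C (B \<odot> \<Theta>) \<Theta>"
    "inverse_of C \<zeta> \<cdot>\<^bsub>C\<^esub> \<zeta> = Idt C \<Theta>" "\<zeta> \<cdot>\<^bsub>C\<^esub> inverse_of C \<zeta> = Idt C (B \<odot> \<Theta>)"
    using g 1 2 by auto
qed

text \<open>Invertibility of \<open>\<zeta>\<close> turns the square of a coalgebra morphism into a
  fixed-point equation. Over the opposite of \<open>D\<close> this also serves for
  \<open>\<alpha>\<close>.\<close>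

lemma final_coalgebra_eq_iff:
  assumes "is_functor C C B" "final_coalgebra C B \<Theta> \<zeta>"
    and h: "h \<in> hom C X \<Theta>" and k: "k \<in> hom C X (B \<odot> \<Theta>)"
  shows "\<zeta> \<cdot>\<^bsub>C\<^esub> h = k \<longleftrightarrow> h = inverse_of C \<zeta> \<cdot>\<^bsub>C\<^esub> k"
proof -
  interpret B: is_functor C C B by fact
  note inv = final_coalgebra_inverse[OF assms(1,2)]
  have "\<zeta> \<in> hom C \<Theta> (B \<odot> \<Theta>)"
    using assms(2) by (auto simp: final_coalgebra_def)
  then show ?thesis
    using h k inv(1) B.C.cmp_reassoc[OF inv(2), of h] B.C.cmp_reassoc[OF inv(3), of k]
    by (auto simp: in_hom_iff)
qed

text \<open>The solutions over \<open>c\<close> are exactly the coalgebra morphisms from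
  \<open>c\<close> to \<open>\<zeta>\<close>, so finality supplies the unique one.\<close>

lemma final_coalgebra_corecursive:
  assumes "is_functor C C B" "final_coalgebra C B \<Theta> \<zeta>"
  shows "corecursive C B \<Theta> (inverse_of C \<zeta>)"
  unfolding corecursive_def
proof (intro conjI ballI)
  interpret B: is_functor C C B by fact
  show "\<Theta> \<in> Ob C"
    using assms(2) by (simp add: final_coalgebra_def)
  show "inverse_of C \<zeta> \<in> hom C (B \<odot> \<Theta>) \<Theta>"
    by (fact final_coalgebra_inverse(1)[OF assms])
  fix X c
  assume X: "X \<in> Ob C" and c: "c \<in> hom C X (B \<odot> X)"
  have "h \<in> hom C X \<Theta> \<and> h = inverse_of C \<zeta> \<cdot>\<^bsub>C\<^esub> (B \<star> h) \<cdot>\<^bsub>C\<^esub> c \<longleftrightarrow>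
      h \<in> hom C X \<Theta> \<and> \<zeta> \<cdot>\<^bsub>C\<^esub> h = (B \<star> h) \<cdot>\<^bsub>C\<^esub> c" for h
    using final_coalgebra_eq_iff[OF assms, of h X "(B \<star> h) \<cdot>\<^bsub>C\<^esub> c"] c by (auto simp: in_hom_iff)
  then show "\<exists>!h. h \<in> hom C X \<Theta> \<and> h = inverse_of C \<zeta> \<cdot>\<^bsub>C\<^esub> (B \<star> h) \<cdot>\<^bsub>C\<^esub> c"
    using assms(2) X c unfolding final_coalgebra_def by simp
qed

section \<open>Corecursive algebras from an adjunction and an initial algebra\<close>

lemma initial_algebra_op_cat:
  "initial_algebra D L \<Phi> \<alpha> \<Longrightarrow> final_coalgebra (op_cat D) L \<Phi> \<alpha>"
  by (simp add: initial_algebra_def final_coalgebra_def)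

text \<open>A \<open>B\<close>-coalgebra \<open>c\<close> on \<open>X\<close> induces an
  \<open>L\<close>-coalgebra on \<open>F \<odot> X\<close>, and the hom-set bijection matches the
  coalgebra morphisms from it into \<open>\<omega>\<close> with the solutions over \<open>c\<close>.
  In the application \<open>E\<close> is the opposite of \<open>D\<close> and
  \<open>\<omega>\<close> is \<open>\<alpha>\<close>.\<close>

lemma left_adjoint_corecursive:
  assumes "left_adjoint C E F G" "is_functor C C B" "is_functor E E L"
    and "nat_trans E C (B \<circ>\<^sub>F G) (G \<circ>\<^sub>F L) \<delta>" and fin: "final_coalgebra E L \<Phi> \<omega>"
  shows "corecursive C B (G \<odot> \<Phi>) ((G \<star> inverse_of E \<omega>) \<cdot>\<^bsub>C\<^esub> \<delta> \<Phi>)"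
proof -
  obtain \<phi> where
    bij: "\<And>X Y. X \<in> Ob C \<Longrightarrow> Y \<in> Ob E \<Longrightarrow>
      bij_betw (\<phi> X Y) (hom E (F \<odot> X) Y) (hom C X (G \<odot> Y))"
    and nat: "\<And>X X' Y Y' u f v. \<lbrakk>X \<in> Ob C; X' \<in> Ob C; Y \<in> Ob E; Y' \<in> Ob E; u \<in> hom C X' X;
      f \<in> hom E (F \<odot> X) Y; v \<in> hom E Y Y'\<rbrakk> \<Longrightarrow>
      \<phi> X' Y' (v \<cdot>\<^bsub>E\<^esub> f \<cdot>\<^bsub>E\<^esub> (F \<star> u)) = (G \<star> v) \<cdot>\<^bsub>C\<^esub> \<phi> X Y f \<cdot>\<^bsub>C\<^esub> u"
    and "is_functor C E F" "is_functor E C G"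
    using assms(1) unfolding left_adjoint_def by blast
  interpret F: is_functor C E F by fact
  interpret G: is_functor E C G by fact
  interpret B: is_functor C C B by fact
  interpret L: is_functor E E L by fact
  interpret \<delta>: nat_trans E C "B \<circ>\<^sub>F G" "G \<circ>\<^sub>F L" \<delta> by fact
  let ?i = "inverse_of E \<omega>"
  have \<Phi> [simp]: "\<Phi> \<in> Ob E"
    using fin by (simp add: final_coalgebra_def)
  have inv [simp]: "?i \<in> Ar E" "Dom E ?i = L \<odot> \<Phi>" "Cod E ?i = \<Phi>"
    using final_coalgebra_inverse(1)[OF assms(3) fin] by (auto simp: in_hom_iff)
  have \<phi>_hom: "\<phi> X Y f \<in> hom C X (G \<odot> Y)"
    if "X \<in> Ob C" "Y \<in> Ob E" "f \<in> hom E (F \<odot> X) Y" for X Y f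
    using bij[OF that(1,2)] that(3) by (auto simp: bij_betw_def)
  \<comment> \<open>Naturality of \<open>\<phi>\<close> in its second argument alone, by taking
    \<open>u\<close> to be an identity.\<close>
  have post: "\<phi> X (Cod E v) (v \<cdot>\<^bsub>E\<^esub> f) = (G \<star> v) \<cdot>\<^bsub>C\<^esub> \<phi> X (Dom E v) f"
    if "X \<in> Ob C" "v \<in> Ar E" "f \<in> hom E (F \<odot> X) (Dom E v)" for X v f
    using nat[of X X "Dom E v" "Cod E v" "Idt C X" f v] \<phi>_hom[of X "Dom E v" f] that
    by (simp add: in_hom_iff)
  show ?thesis
    unfolding corecursive_def
  proof (intro conjI ballI)
    fix X c
    assume X [simp]: "X \<in> Ob C" and c: "c \<in> hom C X (B \<odot> X)"
    then have c' [simp]: "c \<in> Ar C" "Dom C c = X" "Cod C c = B \<odot> X"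
      by (auto simp: in_hom_iff)
    \<comment> \<open>The unit of the adjunction at \<open>X\<close>; by \<open>\<phi>_unit\<close>
      every transpose into \<open>G \<odot> \<Phi>\<close> factors through it.\<close>
    let ?u = "\<phi> X (F \<odot> X) (Idt E (F \<odot> X))"
    have u [simp]: "?u \<in> Ar C" "Dom C ?u = X" "Cod C ?u = G \<odot> F \<odot> X"
      using \<phi>_hom[of X "F \<odot> X" "Idt E (F \<odot> X)"] by (auto simp: in_hom_iff)
    have \<phi>_unit: "\<phi> X \<Phi> f = (G \<star> f) \<cdot>\<^bsub>C\<^esub> ?u" if "f \<in> hom E (F \<odot> X) \<Phi>" for f
      using post[of X f "Idt E (F \<odot> X)"] that by (auto simp: in_hom_iff)
    \<comment> \<open>Surjectivity of \<open>\<phi>\<close> yields \<open>b\<close>, the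
      \<open>L\<close>-coalgebra on \<open>F \<odot> X\<close> induced by \<open>c\<close>.\<close>
    have "\<delta> (F \<odot> X) \<cdot>\<^bsub>C\<^esub> (B \<star> ?u) \<cdot>\<^bsub>C\<^esub> c \<in> hom C X (G \<odot> L \<odot> F \<odot> X)"
      by (simp add: in_hom_iff)
    also have "\<dots> = \<phi> X (L \<odot> F \<odot> X) ` hom E (F \<odot> X) (L \<odot> F \<odot> X)"
      using bij[of X "L \<odot> F \<odot> X"] by (simp add: bij_betw_def)
    finally obtain b where b: "b \<in> hom E (F \<odot> X) (L \<odot> F \<odot> X)"
      and \<phi>b: "\<phi> X (L \<odot> F \<odot> X) b = \<delta> (F \<odot> X) \<cdot>\<^bsub>C\<^esub> (B \<star> ?u) \<cdot>\<^bsub>C\<^esub> c"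
      by (rule imageE) simp
    have b' [simp]: "b \<in> Ar E" "Dom E b = F \<odot> X" "Cod E b = L \<odot> F \<odot> X"
      using b by (auto simp: in_hom_iff)
    \<comment> \<open>The right side of the equation at \<open>\<phi> X \<Phi> f\<close> is itself a
      transpose, by \<open>post\<close>, naturality of \<open>\<delta>\<close> at \<open>f\<close>
      and \<open>\<phi>_unit\<close>. Injectivity then removes \<open>\<phi>\<close>, and inverting
      \<open>?i\<close> leaves the square of a coalgebra morphism.\<close>
    have sol: "\<phi> X \<Phi> f = ((G \<star> ?i) \<cdot>\<^bsub>C\<^esub> \<delta> \<Phi>) \<cdot>\<^bsub>C\<^esub> (B \<star> \<phi> X \<Phi> f) \<cdot>\<^bsub>C\<^esub> c \<longleftrightarrow>
        \<omega> \<cdot>\<^bsub>E\<^esub> f = (L \<star> f) \<cdot>\<^bsub>E\<^esub> b" if f: "f \<in> hom E (F \<odot> X) \<Phi>" for f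
    proof -
      have f' [simp]: "f \<in> Ar E" "Dom E f = F \<odot> X" "Cod E f = \<Phi>"
        using f by (auto simp: in_hom_iff)
      have nat_f: "\<delta> \<Phi> \<cdot>\<^bsub>C\<^esub> (B \<star> G \<star> f) = (G \<star> L \<star> f) \<cdot>\<^bsub>C\<^esub> \<delta> (F \<odot> X)"
        using \<delta>.naturality_cod[of f \<Phi>] by simp
      have "\<phi> X \<Phi> (?i \<cdot>\<^bsub>E\<^esub> (L \<star> f) \<cdot>\<^bsub>E\<^esub> b) =
          (G \<star> ?i) \<cdot>\<^bsub>C\<^esub> (G \<star> L \<star> f) \<cdot>\<^bsub>C\<^esub> \<delta> (F \<odot> X) \<cdot>\<^bsub>C\<^esub> (B \<star> ?u) \<cdot>\<^bsub>C\<^esub> c"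
        using post[of X "?i \<cdot>\<^bsub>E\<^esub> (L \<star> f)" b] b by (simp add: \<phi>b)
      also have "\<dots> = ((G \<star> ?i) \<cdot>\<^bsub>C\<^esub> \<delta> \<Phi>) \<cdot>\<^bsub>C\<^esub> (B \<star> \<phi> X \<Phi> f) \<cdot>\<^bsub>C\<^esub> c"
        by (simp add: \<phi>_unit[OF f] F.C.cmp_reassoc[OF nat_f])
      finally have eq: "((G \<star> ?i) \<cdot>\<^bsub>C\<^esub> \<delta> \<Phi>) \<cdot>\<^bsub>C\<^esub> (B \<star> \<phi> X \<Phi> f) \<cdot>\<^bsub>C\<^esub> c =
          \<phi> X \<Phi> (?i \<cdot>\<^bsub>E\<^esub> (L \<star> f) \<cdot>\<^bsub>E\<^esub> b)" by (rule sym)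
      have "inj_on (\<phi> X \<Phi>) (hom E (F \<odot> X) \<Phi>)"
        using bij[of X \<Phi>] by (simp add: bij_betw_def)
      then have "\<phi> X \<Phi> f = \<phi> X \<Phi> (?i \<cdot>\<^bsub>E\<^esub> (L \<star> f) \<cdot>\<^bsub>E\<^esub> b) \<longleftrightarrow> f = ?i \<cdot>\<^bsub>E\<^esub> (L \<star> f) \<cdot>\<^bsub>E\<^esub> b"
        by (rule inj_on_eq_iff) (simp_all add: in_hom_iff)
      then show ?thesis
        using final_coalgebra_eq_iff[OF assms(3) fin f, of "(L \<star> f) \<cdot>\<^bsub>E\<^esub> b"]
        unfolding eq by (simp add: in_hom_iff)
    qed
    have ex1: "\<exists>!f. f \<in> hom E (F \<odot> X) \<Phi> \<and> \<omega> \<cdot>\<^bsub>E\<^esub> f = (L \<star> f) \<cdot>\<^bsub>E\<^esub> b"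
      using fin b F.fob_ob[OF X] unfolding final_coalgebra_def by blast
    have surj: "\<phi> X \<Phi> ` hom E (F \<odot> X) \<Phi> = hom C X (G \<odot> \<Phi>)"
      using bij[of X \<Phi>] by (simp add: bij_betw_def)
    show "\<exists>!h. h \<in> hom C X (G \<odot> \<Phi>) \<and>
        h = ((G \<star> ?i) \<cdot>\<^bsub>C\<^esub> \<delta> \<Phi>) \<cdot>\<^bsub>C\<^esub> (B \<star> h) \<cdot>\<^bsub>C\<^esub> c"
    proof (rule ex_ex1I)
      show "\<exists>h. h \<in> hom C X (G \<odot> \<Phi>) \<and> h = ((G \<star> ?i) \<cdot>\<^bsub>C\<^esub> \<delta> \<Phi>) \<cdot>\<^bsub>C\<^esub> (B \<star> h) \<cdot>\<^bsub>C\<^esub> c"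
        using ex1 sol \<phi>_hom[OF X \<Phi>] by blast
    next
      fix h k
      assume h: "h \<in> hom C X (G \<odot> \<Phi>) \<and> h = ((G \<star> ?i) \<cdot>\<^bsub>C\<^esub> \<delta> \<Phi>) \<cdot>\<^bsub>C\<^esub> (B \<star> h) \<cdot>\<^bsub>C\<^esub> c"
        and k: "k \<in> hom C X (G \<odot> \<Phi>) \<and> k = ((G \<star> ?i) \<cdot>\<^bsub>C\<^esub> \<delta> \<Phi>) \<cdot>\<^bsub>C\<^esub> (B \<star> k) \<cdot>\<^bsub>C\<^esub> c"
      \<comment> \<open>By surjectivity arbitrary solutions are transposes, so uniqueness can be
        checked in \<open>E\<close>.\<close>
      obtain f where f: "f \<in> hom E (F \<odot> X) \<Phi>" "h = \<phi> X \<Phi> f"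
        using h surj by blast
      obtain g where g: "g \<in> hom E (F \<odot> X) \<Phi>" "k = \<phi> X \<Phi> g"
        using k surj by blast
      show "h = k"
        using ex1 sol[OF f(1)] sol[OF g(1)] h k f g by metis
    qed
  qed (simp_all add: in_hom_iff)
qed

section \<open>Eilenberg-Moore laws and determinization\<close>

definition em_algebra :: "('o, 'a) precategory \<Rightarrow> ('o, 'a, 'o, 'a) functor_data \<Rightarrow>
    ('o \<Rightarrow> 'a) \<Rightarrow> ('o \<Rightarrow> 'a) \<Rightarrow> 'o \<Rightarrow> 'a \<Rightarrow> bool" where
  "em_algebra C T \<eta> \<mu> A t \<longleftrightarrow> t \<in> hom C (T \<odot> A) A \<and>
     t \<cdot>\<^bsub>C\<^esub> \<eta> A = Idt C A \<and> t \<cdot>\<^bsub>C\<^esub> \<mu> A = t \<cdot>\<^bsub>C\<^esub> (T \<star> t)"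

context em_law
begin

lemma em_law_components [simp]:
  assumes "X \<in> Ob C"
  shows "\<kappa> X \<in> Ar C" "Dom C (\<kappa> X) = T \<odot> B \<odot> X" "Cod C (\<kappa> X) = B \<odot> T \<odot> X"
    "\<mu> X \<in> Ar C" "Dom C (\<mu> X) = T \<odot> T \<odot> X" "Cod C (\<mu> X) = T \<odot> X"
    "\<eta> X \<in> Ar C" "Dom C (\<eta> X) = X" "Cod C (\<eta> X) = T \<odot> X"
  using assms \<kappa>.component_simps[of X] mult.component_simps[of X] unit.component_simps[of X]
  by simp_all

lemma kappa_natural:
  "f \<in> Ar C \<Longrightarrow> Cod C f = Y \<Longrightarrow> \<kappa> Y \<cdot> (T \<star> B \<star> f) = (B \<star> T \<star> f) \<cdot> \<kappa> (Dom C f)"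
  using \<kappa>.naturality_cod[of f Y] by simp

lemma mu_natural:
  "f \<in> Ar C \<Longrightarrow> Dom C f = X \<Longrightarrow> (T \<star> f) \<cdot> \<mu> X = \<mu> (Cod C f) \<cdot> (T \<star> T \<star> f)"
  using mult.naturality_dom[of f X] by simp

lemma eta_natural:
  "f \<in> Ar C \<Longrightarrow> Dom C f = X \<Longrightarrow> (T \<star> f) \<cdot> \<eta> X = \<eta> (Cod C f) \<cdot> f"
  using unit.naturality_dom[of f X] by simp

lemmas kappa_natural_reassoc = B.C.cmp_reassoc[OF kappa_natural]

text \<open>Compatibility carries \<open>t\<close> past \<open>l\<close>, and naturality of
  \<open>\<kappa>\<close> carries it past \<open>B \<star> k\<close>. If \<open>k\<close> solves the
  equation over \<open>c\<close>, this makes \<open>t \<cdot> (T \<star> k)\<close> a solution over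
  \<open>\<kappa> Y \<cdot> (T \<star> c)\<close>. \<open>Y\<close> differs from \<open>X\<close> to
  cover \<open>c\<close> with values in \<open>B T X\<close>.\<close>

lemma compatible_solution:
  assumes l: "l \<in> hom C (B \<odot> A) A" and t: "t \<in> hom C (T \<odot> A) A"
    and compat: "t \<cdot> (T \<star> l) = l \<cdot> (B \<star> t) \<cdot> \<kappa> A"
    and c: "c \<in> hom C X (B \<odot> Y)" and k: "k \<in> hom C Y A"
  shows "t \<cdot> (T \<star> (l \<cdot> (B \<star> k) \<cdot> c)) = l \<cdot> (B \<star> (t \<cdot> (T \<star> k))) \<cdot> \<kappa> Y \<cdot> (T \<star> c)"
proof -
  have [simp]: "l \<in> Ar C" "Dom C l = B \<odot> A" "Cod C l = A" "t \<in> Ar C" "Dom C t = T \<odot> A"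
    "Cod C t = A" "c \<in> Ar C" "Dom C c = X" "Cod C c = B \<odot> Y" "k \<in> Ar C" "Dom C k = Y" "Cod C k = A"
    using assms by (auto simp: in_hom_iff)
  have [simp]: "A \<in> Ob C" "Y \<in> Ob C"
    using B.C.dom_cod_ob[of k] by simp_all
  show ?thesis
    by (simp add: B.C.cmp_reassoc[OF compat] kappa_natural_reassoc)
qed

text \<open>The unique solution \<open>k\<close> over the determinization is a homomorphism from the
  free algebra on \<open>X\<close>, and its restriction \<open>k \<cdot> \<eta> X\<close> is the
  solution sought. Conversely any solution \<open>h\<close> extends to
  \<open>t \<cdot> (T \<star> h)\<close>, which must be \<open>k\<close>.\<close>

lemma corecursive_determinization:
  assumes corec: "corecursive C B A l" and alg: "em_algebra C T \<eta> \<mu> A t"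
    and compat: "t \<cdot> (T \<star> l) = l \<cdot> (B \<star> t) \<cdot> \<kappa> A"
  shows "corecursive C (B \<circ>\<^sub>F T) A (l \<cdot> (B \<star> t))"
proof -
  have A [simp]: "A \<in> Ob C" and l: "l \<in> hom C (B \<odot> A) A" and t: "t \<in> hom C (T \<odot> A) A"
    and t_unit: "t \<cdot> \<eta> A = Idt C A" and t_mult: "t \<cdot> \<mu> A = t \<cdot> (T \<star> t)"
    using corec alg by (auto simp: corecursive_def em_algebra_def)
  have lt [simp]: "l \<in> Ar C" "Dom C l = B \<odot> A" "Cod C l = A"
    "t \<in> Ar C" "Dom C t = T \<odot> A" "Cod C t = A"
    using l t by (auto simp: in_hom_iff)
  show ?thesis
    unfolding corecursive_def comp_functor_simps
  proof (intro conjI ballI)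
    fix X c
    assume X [simp]: "X \<in> Ob C" and c: "c \<in> hom C X (B \<odot> T \<odot> X)"
    have c' [simp]: "c \<in> Ar C" "Dom C c = X" "Cod C c = B \<odot> T \<odot> X"
      using c by (auto simp: in_hom_iff)
    \<comment> \<open>The extension of \<open>c\<close> to the free algebra, where
      \<open>B T X\<close> carries the algebra structure given by \<open>\<kappa>\<close> followed
      by \<open>B \<star> \<mu> X\<close>.\<close>
    define d where "d = (B \<star> \<mu> X) \<cdot> \<kappa> (T \<odot> X) \<cdot> (T \<star> c)"
    have d: "d \<in> hom C (T \<odot> X) (B \<odot> T \<odot> X)"
      by (simp add: d_def in_hom_iff)
    then have d' [simp]: "d \<in> Ar C" "Dom C d = T \<odot> X" "Cod C d = B \<odot> T \<odot> X"
      by (auto simp: in_hom_iff)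
    obtain k where k: "k \<in> hom C (T \<odot> X) A" and k_eq: "k = l \<cdot> (B \<star> k) \<cdot> d"
      using corec d T.fob_ob[OF X] unfolding corecursive_def by blast
    have k' [simp]: "k \<in> Ar C" "Dom C k = T \<odot> X" "Cod C k = A"
      using k by (auto simp: in_hom_iff)
    \<comment> \<open>Both sides solve the equation over
      \<open>\<kappa> (T \<odot> X) \<cdot> (T \<star> d)\<close>, a coalgebra on
      \<open>T T X\<close>.\<close>
    have k_hom: "t \<cdot> (T \<star> k) = k \<cdot> \<mu> X"
    proof (rule corecursive_unique[OF corec])
      show "\<kappa> (T \<odot> X) \<cdot> (T \<star> d) \<in> hom C (T \<odot> T \<odot> X) (B \<odot> T \<odot> T \<odot> X)"
        by (simp add: in_hom_iff)
      show "t \<cdot> (T \<star> k) = l \<cdot> (B \<star> (t \<cdot> (T \<star> k))) \<cdot> \<kappa> (T \<odot> X) \<cdot> (T \<star> d)"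
        using compatible_solution[OF l t compat d k] k_eq by metis
      \<comment> \<open>\<open>d\<close> is a homomorphism of \<open>T\<close>-algebras: this
        combines naturality of \<open>\<mu>\<close> and \<open>\<kappa>\<close>, the multiplication
        axiom of the law and associativity of the monad.\<close>
      have "d \<cdot> \<mu> X = (B \<star> \<mu> X) \<cdot> \<kappa> (T \<odot> X) \<cdot> (T \<star> c) \<cdot> \<mu> X"
        by (simp add: d_def)
      also have "\<dots> = (B \<star> \<mu> X) \<cdot> (\<kappa> (T \<odot> X) \<cdot> \<mu> (B \<odot> T \<odot> X)) \<cdot> (T \<star> T \<star> c)"
        by (simp add: mu_natural)
      also have "\<dots> = (B \<star> (\<mu> X \<cdot> \<mu> (T \<odot> X))) \<cdot> \<kappa> (T \<odot> T \<odot> X) \<cdot> (T \<star> \<kappa> (T \<odot> X)) \<cdot> (T \<star> T \<star> c)"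
        by (simp add: em_mult)
      also have "\<dots> = (B \<star> (\<mu> X \<cdot> (T \<star> \<mu> X))) \<cdot> \<kappa> (T \<odot> T \<odot> X) \<cdot> (T \<star> \<kappa> (T \<odot> X)) \<cdot> (T \<star> T \<star> c)"
        by (simp only: mult_assoc[OF X])
      also have "\<dots> = (B \<star> \<mu> X) \<cdot> \<kappa> (T \<odot> X) \<cdot> (T \<star> d)"
        by (simp add: d_def kappa_natural_reassoc)
      finally have d_mult: "d \<cdot> \<mu> X = (B \<star> \<mu> X) \<cdot> \<kappa> (T \<odot> X) \<cdot> (T \<star> d)" .
      have "k \<cdot> \<mu> X = (l \<cdot> (B \<star> k) \<cdot> d) \<cdot> \<mu> X"
        by (simp only: k_eq[symmetric])
      also have "\<dots> = l \<cdot> (B \<star> (k \<cdot> \<mu> X)) \<cdot> \<kappa> (T \<odot> X) \<cdot> (T \<star> d)"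
        by (simp add: d_mult)
      finally show "k \<cdot> \<mu> X = l \<cdot> (B \<star> (k \<cdot> \<mu> X)) \<cdot> \<kappa> (T \<odot> X) \<cdot> (T \<star> d)" .
    qed (simp_all add: in_hom_iff)
    show "\<exists>!h. h \<in> hom C X A \<and> h = (l \<cdot> (B \<star> t)) \<cdot> (B \<star> T \<star> h) \<cdot> c"
    proof (rule ex1I[of _ "k \<cdot> \<eta> X"], intro conjI)
      show "k \<cdot> \<eta> X \<in> hom C X A"
        by (simp add: in_hom_iff)
      \<comment> \<open>Being a homomorphism, \<open>k\<close> is recovered by extending its
        restriction along the unit.\<close>
      have "t \<cdot> (T \<star> (k \<cdot> \<eta> X)) = (t \<cdot> (T \<star> k)) \<cdot> (T \<star> \<eta> X)"
        by simp
      also have "\<dots> = k \<cdot> \<mu> X \<cdot> (T \<star> \<eta> X)"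
        unfolding k_hom by simp
      also have "\<dots> = k"
        by (simp add: unit_right)
      finally have t_k: "t \<cdot> (T \<star> (k \<cdot> \<eta> X)) = k" .
      \<comment> \<open>\<open>d\<close> restricts to \<open>c\<close>, so the equation of
        \<open>k\<close> restricts to one over \<open>c\<close>.\<close>
      have "d \<cdot> \<eta> X = (B \<star> \<mu> X) \<cdot> (\<kappa> (T \<odot> X) \<cdot> \<eta> (B \<odot> T \<odot> X)) \<cdot> c"
        by (simp add: d_def eta_natural)
      also have "\<dots> = (B \<star> (\<mu> X \<cdot> \<eta> (T \<odot> X))) \<cdot> c"
        by (simp add: em_unit)
      also have "\<dots> = c"
        by (simp add: unit_left)
      finally have d_unit: "d \<cdot> \<eta> X = c" .
      have "k \<cdot> \<eta> X = (l \<cdot> (B \<star> k) \<cdot> d) \<cdot> \<eta> X"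
        by (simp only: k_eq[symmetric])
      also have "\<dots> = l \<cdot> (B \<star> k) \<cdot> c"
        by (simp add: d_unit)
      also have "\<dots> = l \<cdot> (B \<star> (t \<cdot> (T \<star> (k \<cdot> \<eta> X)))) \<cdot> c"
        by (simp only: t_k)
      also have "\<dots> = (l \<cdot> (B \<star> t)) \<cdot> (B \<star> T \<star> (k \<cdot> \<eta> X)) \<cdot> c"
        by simp
      finally show "k \<cdot> \<eta> X = (l \<cdot> (B \<star> t)) \<cdot> (B \<star> T \<star> (k \<cdot> \<eta> X)) \<cdot> c" .
    next
      fix h
      assume h: "h \<in> hom C X A \<and> h = (l \<cdot> (B \<star> t)) \<cdot> (B \<star> T \<star> h) \<cdot> c"
      then have h' [simp]: "h \<in> Ar C" "Dom C h = X" "Cod C h = A"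
        by (auto simp: in_hom_iff)
      have "(l \<cdot> (B \<star> t)) \<cdot> (B \<star> T \<star> h) \<cdot> c = l \<cdot> (B \<star> (t \<cdot> (T \<star> h))) \<cdot> c"
        by simp
      with h have h_eq: "h = l \<cdot> (B \<star> (t \<cdot> (T \<star> h))) \<cdot> c"
        by metis
      have th: "t \<cdot> (T \<star> h) \<in> hom C (T \<odot> X) A"
        by (simp add: in_hom_iff)
      \<comment> \<open>Algebra associativity turns the nested
        \<open>t \<cdot> (T \<star> t)\<close> into a multiplication, which is absorbed into
        \<open>d\<close>; thus the extension of \<open>h\<close> solves the equation over
        \<open>d\<close>.\<close>
      have "t \<cdot> (T \<star> h) = k"
      proof (rule corecursive_unique[OF corec _ d th _ k k_eq])
        have "t \<cdot> (T \<star> h) = l \<cdot> (B \<star> (t \<cdot> (T \<star> (t \<cdot> (T \<star> h))))) \<cdot> \<kappa> (T \<odot> X) \<cdot> (T \<star> c)"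
          using compatible_solution[OF l t compat c th] h_eq by metis
        also have "t \<cdot> (T \<star> (t \<cdot> (T \<star> h))) = (t \<cdot> (T \<star> t)) \<cdot> (T \<star> T \<star> h)"
          by simp
        also have "\<dots> = (t \<cdot> \<mu> A) \<cdot> (T \<star> T \<star> h)"
          by (simp only: t_mult)
        also have "\<dots> = (t \<cdot> (T \<star> h)) \<cdot> \<mu> X"
          by (simp add: mu_natural)
        also have "l \<cdot> (B \<star> ((t \<cdot> (T \<star> h)) \<cdot> \<mu> X)) \<cdot> \<kappa> (T \<odot> X) \<cdot> (T \<star> c) =
            l \<cdot> (B \<star> (t \<cdot> (T \<star> h))) \<cdot> d"
          by (simp add: d_def)
        finally show "t \<cdot> (T \<star> h) = l \<cdot> (B \<star> (t \<cdot> (T \<star> h))) \<cdot> d" .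
      qed simp
      then have "k \<cdot> \<eta> X = (t \<cdot> (T \<star> h)) \<cdot> \<eta> X"
        by simp
      also have "\<dots> = (t \<cdot> \<eta> A) \<cdot> h"
        by (simp add: eta_natural)
      also have "\<dots> = h"
        by (simp add: t_unit del: B.C.cmp_assoc_simp)
      finally show "h = k \<cdot> \<eta> X" by (rule sym)
    qed
  qed (simp_all add: in_hom_iff)
qed

text \<open>By finality it suffices that both sides of each law are coalgebra morphisms from a
  common source: \<open>\<zeta>\<close> for the unit law, and \<open>T T \<zeta>\<close> followed by
  two uses of \<open>\<kappa>\<close> for the multiplication law. The two axioms of the law
  \<open>\<kappa>\<close> match those of the algebra.\<close>

lemma final_coalgebra_em_algebra:
  assumes fin: "final_coalgebra C B \<Theta> \<zeta>"
    and a: "a \<in> hom C (T \<odot> \<Theta>) \<Theta>" and a_eq: "\<zeta> \<cdot> a = (B \<star> a) \<cdot> \<kappa> \<Theta> \<cdot> (T \<star> \<zeta>)"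
  shows "em_algebra C T \<eta> \<mu> \<Theta> a"
proof -
  have \<Theta> [simp]: "\<Theta> \<in> Ob C" and \<zeta>: "\<zeta> \<in> hom C \<Theta> (B \<odot> \<Theta>)"
    using fin by (auto simp: final_coalgebra_def)
  have [simp]: "\<zeta> \<in> Ar C" "Dom C \<zeta> = \<Theta>" "Cod C \<zeta> = B \<odot> \<Theta>"
    "a \<in> Ar C" "Dom C a = T \<odot> \<Theta>" "Cod C a = \<Theta>"
    using \<zeta> a by (auto simp: in_hom_iff)
  note a_eq_reassoc = B.C.cmp_reassoc[OF a_eq]
  \<comment> \<open>Simplification distributes \<open>T\<close> over composites, so the defining
    square of \<open>a\<close> is needed under \<open>T\<close> in expanded form.\<close>
  have Ta_eq: "(T \<star> \<zeta>) \<cdot> (T \<star> a) = (T \<star> B \<star> a) \<cdot> (T \<star> \<kappa> \<Theta>) \<cdot> (T \<star> T \<star> \<zeta>)"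
    using arg_cong[OF a_eq, of "far T"] by simp
  have unit: "a \<cdot> \<eta> \<Theta> = Idt C \<Theta>"
  proof (rule final_coalgebra_unique[OF fin \<Theta> \<zeta>])
    show "\<zeta> \<cdot> a \<cdot> \<eta> \<Theta> = (B \<star> (a \<cdot> \<eta> \<Theta>)) \<cdot> \<zeta>"
      by (simp add: a_eq_reassoc eta_natural B.C.cmp_reassoc[OF em_unit])
  qed (simp_all add: in_hom_iff)
  have mult: "a \<cdot> \<mu> \<Theta> = a \<cdot> (T \<star> a)"
  proof (rule final_coalgebra_unique[OF fin])
    show "\<kappa> (T \<odot> \<Theta>) \<cdot> (T \<star> \<kappa> \<Theta>) \<cdot> (T \<star> T \<star> \<zeta>) \<in> hom C (T \<odot> T \<odot> \<Theta>) (B \<odot> T \<odot> T \<odot> \<Theta>)"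
      by (simp add: in_hom_iff)
    show "\<zeta> \<cdot> a \<cdot> \<mu> \<Theta> =
        (B \<star> (a \<cdot> \<mu> \<Theta>)) \<cdot> \<kappa> (T \<odot> \<Theta>) \<cdot> (T \<star> \<kappa> \<Theta>) \<cdot> (T \<star> T \<star> \<zeta>)"
      by (simp add: a_eq_reassoc mu_natural B.C.cmp_reassoc[OF em_mult])
    show "\<zeta> \<cdot> a \<cdot> (T \<star> a) =
        (B \<star> (a \<cdot> (T \<star> a))) \<cdot> \<kappa> (T \<odot> \<Theta>) \<cdot> (T \<star> \<kappa> \<Theta>) \<cdot> (T \<star> T \<star> \<zeta>)"
      by (simp add: a_eq_reassoc Ta_eq kappa_natural_reassoc)
  qed (simp_all add: in_hom_iff)
  show ?thesis
    using a unit mult by (simp add: em_algebra_def)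
qed

text \<open>This is the square defining \<open>a\<close> with \<open>\<zeta>\<close> inverted at
  both ends.\<close>

lemma final_coalgebra_compatible:
  assumes fin: "final_coalgebra C B \<Theta> \<zeta>"
    and a: "a \<in> hom C (T \<odot> \<Theta>) \<Theta>" and a_eq: "\<zeta> \<cdot> a = (B \<star> a) \<cdot> \<kappa> \<Theta> \<cdot> (T \<star> \<zeta>)"
  shows "a \<cdot> (T \<star> inverse_of C \<zeta>) = inverse_of C \<zeta> \<cdot> (B \<star> a) \<cdot> \<kappa> \<Theta>"
proof -
  note inv = final_coalgebra_inverse[OF B.is_functor_axioms fin]
  have [simp]: "\<Theta> \<in> Ob C" "\<zeta> \<in> Ar C" "Dom C \<zeta> = \<Theta>" "Cod C \<zeta> = B \<odot> \<Theta>"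
    "a \<in> Ar C" "Dom C a = T \<odot> \<Theta>" "Cod C a = \<Theta>"
    "inverse_of C \<zeta> \<in> Ar C" "Dom C (inverse_of C \<zeta>) = B \<odot> \<Theta>" "Cod C (inverse_of C \<zeta>) = \<Theta>"
    using fin a inv(1) by (auto simp: in_hom_iff final_coalgebra_def)
  have "(T \<star> \<zeta>) \<cdot> (T \<star> inverse_of C \<zeta>) = Idt C (T \<odot> B \<odot> \<Theta>)"
    using arg_cong[OF inv(3), of "far T"] by simp
  then have "\<zeta> \<cdot> a \<cdot> (T \<star> inverse_of C \<zeta>) = (B \<star> a) \<cdot> \<kappa> \<Theta>"
    by (simp add: B.C.cmp_reassoc[OF a_eq])
  then show ?thesis
    by (subst (asm) final_coalgebra_eq_iff[OF B.is_functor_axioms fin]) (simp_all add: in_hom_iff)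
qed

end

section \<open>Comparison of the Eilenberg-Moore and the logical semantics\<close>

theorem theorem7p4:
  fixes C :: "('o, 'a) precategory" and D :: "('p, 'b) precategory"
    and F :: "('o, 'a, 'p, 'b) functor_data" and G :: "('p, 'b, 'o, 'a) functor_data"
    and B T :: "('o, 'a, 'o, 'a) functor_data" and L :: "('p, 'b, 'p, 'b) functor_data"
    and \<Theta> :: 'o and \<zeta> :: 'a and \<Phi> :: 'p and \<alpha> :: 'b
    and \<eta> \<mu> \<kappa> :: "'o \<Rightarrow> 'a" and \<delta> \<tau> :: "'p \<Rightarrow> 'a"
    and a l_em l_log e :: 'a
  assumes "category C" and "category D"
    and "left_adjoint C (op_cat D) F G"
    and "is_functor C C B" and "final_coalgebra C B \<Theta> \<zeta>"
    and "monad_on C T \<eta> \<mu>" and "em_law C B T \<eta> \<mu> \<kappa>"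
    and "is_functor D D L" and "initial_algebra D L \<Phi> \<alpha>"
    and "nat_trans (op_cat D) C (B \<circ>\<^sub>F G) (G \<circ>\<^sub>F L) \<delta>"
    and "monad_action C (op_cat D) T \<eta> \<mu> G \<tau>"
    and "a = (THE h. h \<in> hom C (T \<odot> \<Theta>) \<Theta> \<and> \<zeta> \<cdot>\<^bsub>C\<^esub> h = (B \<star> h) \<cdot>\<^bsub>C\<^esub> \<kappa> \<Theta> \<cdot>\<^bsub>C\<^esub> (T \<star> \<zeta>))"
    and "l_em = inverse_of C \<zeta> \<cdot>\<^bsub>C\<^esub> (B \<star> a)"
    and "l_log = (G \<star> inverse_of D \<alpha>) \<cdot>\<^bsub>C\<^esub> \<delta> \<Phi> \<cdot>\<^bsub>C\<^esub> (B \<star> \<tau> \<Phi>)"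
    and "e = (THE h. h \<in> hom C \<Theta> (G \<odot> \<Phi>) \<and>
           h = (G \<star> inverse_of D \<alpha>) \<cdot>\<^bsub>C\<^esub> \<delta> \<Phi> \<cdot>\<^bsub>C\<^esub> (B \<star> h) \<cdot>\<^bsub>C\<^esub> \<zeta>)"
    and "\<And>Y. Y \<in> Ob D \<Longrightarrow>
           \<delta> Y \<cdot>\<^bsub>C\<^esub> (B \<star> \<tau> Y) \<cdot>\<^bsub>C\<^esub> \<kappa> (G \<odot> Y) = \<tau> (L \<odot> Y) \<cdot>\<^bsub>C\<^esub> (T \<star> \<delta> Y)"
  shows "e \<cdot>\<^bsub>C\<^esub> l_em = l_log \<cdot>\<^bsub>C\<^esub> (B \<star> T \<star> e) \<and>
    (\<forall>X \<in> Ob C. \<forall>c \<in> hom C X (B \<odot> T \<odot> X).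
       e \<cdot>\<^bsub>C\<^esub> (THE h. h \<in> hom C X \<Theta> \<and> h = l_em \<cdot>\<^bsub>C\<^esub> (B \<star> T \<star> h) \<cdot>\<^bsub>C\<^esub> c)
       = (THE h. h \<in> hom C X (G \<odot> \<Phi>) \<and> h = l_log \<cdot>\<^bsub>C\<^esub> (B \<star> T \<star> h) \<cdot>\<^bsub>C\<^esub> c))"
proof -
  interpret law: em_law C B T \<eta> \<mu> \<kappa> by fact
  interpret act: monad_action C "op_cat D" T \<eta> \<mu> G \<tau> by fact
  interpret L: is_functor D D L by fact
  interpret \<delta>: nat_trans "op_cat D" C "B \<circ>\<^sub>F G" "G \<circ>\<^sub>F L" \<delta> by fact
  note fin = \<open>final_coalgebra C B \<Theta> \<zeta>\<close> and fun_B = \<open>is_functor C C B\<close>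
  have fun_L: "is_functor (op_cat D) (op_cat D) L"
    using \<open>is_functor D D L\<close> act.G.C.category_axioms by (rule is_functor_op_cat)
  have fin_op: "final_coalgebra (op_cat D) L \<Phi> \<alpha>"
    using \<open>initial_algebra D L \<Phi> \<alpha>\<close> by (rule initial_algebra_op_cat)
  let ?z = "inverse_of C \<zeta>" and ?i = "inverse_of D \<alpha>"
  \<comment> \<open>The \<open>B\<close>-algebra on \<open>G \<odot> \<Phi>\<close> obtained from
    the adjunction. As a single arrow it gives \<open>l_log\<close> the shape that determinization
    expects.\<close>
  define \<beta> where "\<beta> = (G \<star> ?i) \<cdot>\<^bsub>C\<^esub> \<delta> \<Phi>"
  note inv_\<zeta> = final_coalgebra_inverse[OF fun_B fin]
  have [simp]: "\<Theta> \<in> Ob C" "\<zeta> \<in> Ar C" "Dom C \<zeta> = \<Theta>" "Cod C \<zeta> = B \<odot> \<Theta>" and \<zeta>: "\<zeta> \<in> hom C \<Theta> (B \<odot> \<Theta>)"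
    using fin by (auto simp: final_coalgebra_def in_hom_iff)
  have [simp]: "?z \<in> Ar C" "Dom C ?z = B \<odot> \<Theta>" "Cod C ?z = \<Theta>"
    using inv_\<zeta>(1) by (auto simp: in_hom_iff)
  have [simp]: "\<Phi> \<in> Ob D"
    using fin_op by (simp add: final_coalgebra_def)
  have [simp]: "?i \<in> Ar D" "Cod D ?i = L \<odot> \<Phi>" "Dom D ?i = \<Phi>"
    using final_coalgebra_inverse(1)[OF fun_L fin_op] by (auto simp: in_hom_iff)
  \<comment> \<open>\<open>?i\<close> runs from \<open>\<Phi>\<close> to
    \<open>L \<odot> \<Phi>\<close> in \<open>D\<close>; \<open>G\<close> is defined on the opposite
    category and reverses it.\<close>
  have Gi [simp]: "G \<star> ?i \<in> Ar C" "Dom C (G \<star> ?i) = G \<odot> L \<odot> \<Phi>" "Cod C (G \<star> ?i) = G \<odot> \<Phi>"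
    using act.G.functor_simps[of ?i] by simp_all
  have comp [simp]: "G \<odot> Y \<in> Ob C"
    "\<delta> Y \<in> Ar C" "Dom C (\<delta> Y) = B \<odot> G \<odot> Y" "Cod C (\<delta> Y) = G \<odot> L \<odot> Y"
    "\<tau> Y \<in> Ar C" "Dom C (\<tau> Y) = T \<odot> G \<odot> Y" "Cod C (\<tau> Y) = G \<odot> Y" if "Y \<in> Ob D" for Y
    using that \<delta>.component_simps[of Y] act.\<tau>.component_simps[of Y] act.G.fob_ob[of Y] by simp_all

  \<comment> \<open>Finality applied to the coalgebra on \<open>T \<odot> \<Theta>\<close> that
    \<open>\<kappa>\<close> lifts from \<open>\<zeta>\<close>.\<close>
  have a_ex1: "\<exists>!h. h \<in> hom C (T \<odot> \<Theta>) \<Theta> \<and> \<zeta> \<cdot>\<^bsub>C\<^esub> h = (B \<star> h) \<cdot>\<^bsub>C\<^esub> \<kappa> \<Theta> \<cdot>\<^bsub>C\<^esub> (T \<star> \<zeta>)"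
  proof -
    have "T \<odot> \<Theta> \<in> Ob C" "\<kappa> \<Theta> \<cdot>\<^bsub>C\<^esub> (T \<star> \<zeta>) \<in> hom C (T \<odot> \<Theta>) (B \<odot> T \<odot> \<Theta>)"
      by (simp_all add: in_hom_iff)
    then show ?thesis
      using fin unfolding final_coalgebra_def by blast
  qed
  have a: "a \<in> hom C (T \<odot> \<Theta>) \<Theta>" and a_eq: "\<zeta> \<cdot>\<^bsub>C\<^esub> a = (B \<star> a) \<cdot>\<^bsub>C\<^esub> \<kappa> \<Theta> \<cdot>\<^bsub>C\<^esub> (T \<star> \<zeta>)"
    using theI'[OF a_ex1] unfolding assms(12) by blast+
  have [simp]: "a \<in> Ar C" "Dom C a = T \<odot> \<Theta>" "Cod C a = \<Theta>"
    using a by (auto simp: in_hom_iff)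
  have corec_em: "corecursive C (B \<circ>\<^sub>F T) \<Theta> l_em"
    unfolding assms(13)
    using final_coalgebra_corecursive[OF fun_B fin] law.final_coalgebra_em_algebra[OF fin a a_eq]
      law.final_coalgebra_compatible[OF fin a a_eq]
    by (rule law.corecursive_determinization)

  have \<beta>: "\<beta> \<in> hom C (B \<odot> G \<odot> \<Phi>) (G \<odot> \<Phi>)"
    by (simp add: \<beta>_def in_hom_iff)
  then have [simp]: "\<beta> \<in> Ar C" "Dom C \<beta> = B \<odot> G \<odot> \<Phi>" "Cod C \<beta> = G \<odot> \<Phi>"
    by (auto simp: in_hom_iff)
  have l_log: "l_log = \<beta> \<cdot>\<^bsub>C\<^esub> (B \<star> \<tau> \<Phi>)"
    by (simp add: assms(14) \<beta>_def)
  have corec_\<beta>: "corecursive C B (G \<odot> \<Phi>) \<beta>"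
    using left_adjoint_corecursive[OF assms(3) fun_B fun_L assms(10) fin_op] by (simp add: \<beta>_def)
  have \<tau>: "\<tau> \<Phi> \<in> hom C (T \<odot> G \<odot> \<Phi>) (G \<odot> \<Phi>)"
    by (simp add: in_hom_iff)
  have \<tau>_alg: "em_algebra C T \<eta> \<mu> (G \<odot> \<Phi>) (\<tau> \<Phi>)"
    using \<tau> act.action_unit[of \<Phi>] act.action_mult[of \<Phi>] by (simp add: em_algebra_def)
  have \<tau>_i: "\<tau> \<Phi> \<cdot>\<^bsub>C\<^esub> (T \<star> G \<star> ?i) = (G \<star> ?i) \<cdot>\<^bsub>C\<^esub> \<tau> (L \<odot> \<Phi>)"
    using act.\<tau>.naturality_cod[of ?i \<Phi>] by simp
  \<comment> \<open>The hypothesis relating \<open>\<delta>\<close>, \<open>\<tau>\<close> and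
    \<open>\<kappa>\<close> enters here, at \<open>\<Phi>\<close>; naturality of
    \<open>\<tau>\<close> at \<open>?i\<close> takes care of the factor
    \<open>G \<star> ?i\<close>.\<close>
  have compat_\<beta>: "\<tau> \<Phi> \<cdot>\<^bsub>C\<^esub> (T \<star> \<beta>) = \<beta> \<cdot>\<^bsub>C\<^esub> (B \<star> \<tau> \<Phi>) \<cdot>\<^bsub>C\<^esub> \<kappa> (G \<odot> \<Phi>)"
    by (simp add: \<beta>_def law.B.C.cmp_reassoc[OF \<tau>_i] assms(16))
  have corec_log: "corecursive C (B \<circ>\<^sub>F T) (G \<odot> \<Phi>) l_log"
    unfolding l_log using corec_\<beta> \<tau>_alg compat_\<beta> by (rule law.corecursive_determinization)

  \<comment> \<open>Regrouping into \<open>\<beta>\<close> needs the typing of \<open>h\<close>, so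
    the equation under \<open>THE\<close> is rewritten in the context of the hom-set
    conjunct.\<close>
  have e_def: "e = (THE h. h \<in> hom C \<Theta> (G \<odot> \<Phi>) \<and> h = \<beta> \<cdot>\<^bsub>C\<^esub> (B \<star> h) \<cdot>\<^bsub>C\<^esub> \<zeta>)"
    unfolding assms(15)
    by (intro arg_cong[where f = The] ext conj_cong refl) (simp add: \<beta>_def in_hom_iff)
  have "\<exists>!h. h \<in> hom C \<Theta> (G \<odot> \<Phi>) \<and> h = \<beta> \<cdot>\<^bsub>C\<^esub> (B \<star> h) \<cdot>\<^bsub>C\<^esub> \<zeta>"
    using corec_\<beta> \<zeta> \<open>\<Theta> \<in> Ob C\<close> unfolding corecursive_def by blast
  from theI'[OF this] have e: "e \<in> hom C \<Theta> (G \<odot> \<Phi>)" and e_eq: "e = \<beta> \<cdot>\<^bsub>C\<^esub> (B \<star> e) \<cdot>\<^bsub>C\<^esub> \<zeta>"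
    unfolding e_def[symmetric] by blast+
  have [simp]: "e \<in> Ar C" "Dom C e = \<Theta>" "Cod C e = G \<odot> \<Phi>"
    using e by (auto simp: in_hom_iff)

  \<comment> \<open>The left side solves the equation by the square defining \<open>a\<close>, the
    right side by lifting the equation of \<open>e\<close> with
    \<open>compatible_solution\<close>.\<close>
  have e_alg: "e \<cdot>\<^bsub>C\<^esub> a = \<tau> \<Phi> \<cdot>\<^bsub>C\<^esub> (T \<star> e)"
  proof (rule corecursive_unique[OF corec_\<beta>])
    show "\<kappa> \<Theta> \<cdot>\<^bsub>C\<^esub> (T \<star> \<zeta>) \<in> hom C (T \<odot> \<Theta>) (B \<odot> T \<odot> \<Theta>)"
      by (simp add: in_hom_iff)
    have "e \<cdot>\<^bsub>C\<^esub> a = (\<beta> \<cdot>\<^bsub>C\<^esub> (B \<star> e) \<cdot>\<^bsub>C\<^esub> \<zeta>) \<cdot>\<^bsub>C\<^esub> a"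
      by (simp only: e_eq[symmetric])
    also have "\<dots> = \<beta> \<cdot>\<^bsub>C\<^esub> (B \<star> (e \<cdot>\<^bsub>C\<^esub> a)) \<cdot>\<^bsub>C\<^esub> \<kappa> \<Theta> \<cdot>\<^bsub>C\<^esub> (T \<star> \<zeta>)"
      by (simp add: a_eq)
    finally show "e \<cdot>\<^bsub>C\<^esub> a = \<beta> \<cdot>\<^bsub>C\<^esub> (B \<star> (e \<cdot>\<^bsub>C\<^esub> a)) \<cdot>\<^bsub>C\<^esub> \<kappa> \<Theta> \<cdot>\<^bsub>C\<^esub> (T \<star> \<zeta>)" .
    show "\<tau> \<Phi> \<cdot>\<^bsub>C\<^esub> (T \<star> e) = \<beta> \<cdot>\<^bsub>C\<^esub> (B \<star> (\<tau> \<Phi> \<cdot>\<^bsub>C\<^esub> (T \<star> e))) \<cdot>\<^bsub>C\<^esub> \<kappa> \<Theta> \<cdot>\<^bsub>C\<^esub> (T \<star> \<zeta>)"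
      using law.compatible_solution[OF \<beta> \<tau> compat_\<beta> \<zeta> e] by (simp only: e_eq[symmetric])
  qed (simp_all add: in_hom_iff)

  have l_em_hom [simp]: "l_em \<in> Ar C" "Dom C l_em = B \<odot> T \<odot> \<Theta>" "Cod C l_em = \<Theta>"
    by (simp_all add: assms(13))
  have l_log_hom [simp]: "l_log \<in> Ar C" "Dom C l_log = B \<odot> T \<odot> G \<odot> \<Phi>" "Cod C l_log = G \<odot> \<Phi>"
    by (simp_all add: l_log)
  \<comment> \<open>Unfolding \<open>e\<close> once puts \<open>\<zeta>\<close> next to its inverse;
    after cancellation \<open>e_alg\<close> applies under \<open>B\<close>.\<close>
  have "e \<cdot>\<^bsub>C\<^esub> l_em = (\<beta> \<cdot>\<^bsub>C\<^esub> (B \<star> e) \<cdot>\<^bsub>C\<^esub> \<zeta>) \<cdot>\<^bsub>C\<^esub> ?z \<cdot>\<^bsub>C\<^esub> (B \<star> a)"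
    by (simp only: e_eq[symmetric] assms(13))
  also have "\<dots> = \<beta> \<cdot>\<^bsub>C\<^esub> (B \<star> (e \<cdot>\<^bsub>C\<^esub> a))"
    by (simp add: law.B.C.cmp_reassoc[OF inv_\<zeta>(3)])
  also have "\<dots> = l_log \<cdot>\<^bsub>C\<^esub> (B \<star> T \<star> e)"
    by (simp add: e_alg l_log)
  finally have main: "e \<cdot>\<^bsub>C\<^esub> l_em = l_log \<cdot>\<^bsub>C\<^esub> (B \<star> T \<star> e)" .

  have "e \<cdot>\<^bsub>C\<^esub> (THE h. h \<in> hom C X \<Theta> \<and> h = l_em \<cdot>\<^bsub>C\<^esub> (B \<star> T \<star> h) \<cdot>\<^bsub>C\<^esub> c)
       = (THE h. h \<in> hom C X (G \<odot> \<Phi>) \<and> h = l_log \<cdot>\<^bsub>C\<^esub> (B \<star> T \<star> h) \<cdot>\<^bsub>C\<^esub> c)"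
    if X: "X \<in> Ob C" and c: "c \<in> hom C X (B \<odot> T \<odot> X)" for X c
  proof -
    let ?em = "THE h. h \<in> hom C X \<Theta> \<and> h = l_em \<cdot>\<^bsub>C\<^esub> (B \<star> T \<star> h) \<cdot>\<^bsub>C\<^esub> c"
    have "\<exists>!h. h \<in> hom C X \<Theta> \<and> h = l_em \<cdot>\<^bsub>C\<^esub> (B \<star> T \<star> h) \<cdot>\<^bsub>C\<^esub> c"
      using corec_em X c unfolding corecursive_def comp_functor_simps by blast
    from theI'[OF this] have em: "?em \<in> hom C X \<Theta>"
      and em_eq: "?em = l_em \<cdot>\<^bsub>C\<^esub> (B \<star> T \<star> ?em) \<cdot>\<^bsub>C\<^esub> c" by blast+
    have log_ex1: "\<exists>!h. h \<in> hom C X (G \<odot> \<Phi>) \<and> h = l_log \<cdot>\<^bsub>C\<^esub> (B \<star> T \<star> h) \<cdot>\<^bsub>C\<^esub> c"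
      using corec_log X c unfolding corecursive_def comp_functor_simps by blast
    \<comment> \<open>Composing with \<open>e\<close> turns the equation for \<open>l_em\<close>
      into the one for \<open>l_log\<close>, so uniqueness of the latter's solution identifies the
      image of \<open>?em\<close>.\<close>
    have step: "e \<cdot>\<^bsub>C\<^esub> l_em \<cdot>\<^bsub>C\<^esub> (B \<star> T \<star> h) \<cdot>\<^bsub>C\<^esub> c = l_log \<cdot>\<^bsub>C\<^esub> (B \<star> T \<star> (e \<cdot>\<^bsub>C\<^esub> h)) \<cdot>\<^bsub>C\<^esub> c"
      if "h \<in> hom C X \<Theta>" for h
      using that c X by (simp add: in_hom_iff law.B.C.cmp_reassoc[OF main])
    have "e \<cdot>\<^bsub>C\<^esub> ?em \<in> hom C X (G \<odot> \<Phi>)"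
      using em e by (rule law.B.C.cmp_hom)
    moreover have "e \<cdot>\<^bsub>C\<^esub> ?em = l_log \<cdot>\<^bsub>C\<^esub> (B \<star> T \<star> (e \<cdot>\<^bsub>C\<^esub> ?em)) \<cdot>\<^bsub>C\<^esub> c"
      using step[OF em] by (simp only: em_eq[symmetric])
    ultimately show ?thesis
      by (intro the1_equality[OF log_ex1, symmetric] conjI)
  qed
  with main show ?thesis by blast
qed

end
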